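(* Let $\mathbb{K}$ be a field of characteristic zero, $n\ge1$, and $M\in M_n(\mathbb{K})$ with all principal minors nonzero. Then $\Delta(M)$ is a graded subspace of $\mathbb{K}[x_1,\dots,x_n]$ with \[ \dim_{\mathbb{K}}\Delta(M)_d=\begin{cases}\binom{n}{d}, & 0\le d\le n,\\ 0,&\text{otherwise.}\end{cases} \] In particular $\dim_{\mathbb{K}}\Delta(M)=2^n$.
   Context: Let $M=(M_{ij})$ with $i$-th row $M_i$. For $i\in[n]$ define $\Delta_i(p(\mathbf{x}))=p(\mathbf{x}-M_i)-p(\mathbf{x})$, where $\mathbf{x}-M_i=(x_1-M_{i1},\dots,x_n-M_{in})$, and $\Delta(M)=\bigcap_{i=1}^n\{p:\frac{\partial}{\partial x_i}\Delta_i(p)=0\}$ (the polynomials $p$ for which $\Delta_i(p)$ does not involve $x_i$ for all $i$). A subspace $L$ is graded if it contains the homogeneous components of each of its elements; $L_d$ denotes the subspace of its homogeneous elements of degree $d$. Principal minors are determinants of the submatrices $M_J$ indexed by nonempty $J\subseteq[n]$. *)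

theory Defs
  imports
    "HOL-Library.Poly_Mapping"
    "Jordan_Normal_Form.Determinant"
    "Jordan_Normal_Form.DL_Submatrix"
begin

text \<open>
  A polynomial is a finitely supported map from exponent vectors to coefficients; its ring structure
  is the convolution product of \<^theory>\<open>HOL-Library.Poly_Mapping\<close>. The variables are numbered by
  natural numbers, and the ring in the \<^emph>\<open>n\<close> variables \<open>0, \<dots>, n - 1\<close> is the subset \<open>polys n\<close>.
\<close>

type_synonym 'k mpoly = "(nat \<Rightarrow>\<^sub>0 nat) \<Rightarrow>\<^sub>0 'k"

definition Const :: "'k::comm_ring_1 \<Rightarrow> 'k mpoly"
  where "Const c = Poly_Mapping.single 0 c"

definition Var :: "nat \<Rightarrow> 'k::comm_ring_1 mpoly"
  where "Var i = Poly_Mapping.single (Poly_Mapping.single i 1) 1"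

definition polys :: "nat \<Rightarrow> 'k::comm_ring_1 mpoly set"
  where "polys n = {p. \<forall>m\<in>Poly_Mapping.keys p. Poly_Mapping.keys m \<subseteq> {..<n}}"

definition mp_scale :: "'k::comm_ring_1 \<Rightarrow> 'k mpoly \<Rightarrow> 'k mpoly"
  where "mp_scale c p = Const c * p"

global_interpretation mp: Vector_Spaces.vector_space "mp_scale :: 'k::field \<Rightarrow> 'k mpoly \<Rightarrow> 'k mpoly"
proof
  fix a b :: 'k and x y :: "'k mpoly"
  show "mp_scale a (x + y) = mp_scale a x + mp_scale a y"
    by (simp add: mp_scale_def distrib_left)
  show "mp_scale (a + b) x = mp_scale a x + mp_scale b x"
    by (simp add: mp_scale_def Const_def single_add distrib_right)
  show "mp_scale a (mp_scale b x) = mp_scale (a * b) x"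
    by (simp add: mp_scale_def Const_def mult_single flip: mult.assoc)
  show "mp_scale 1 x = x"
    by (simp add: mp_scale_def Const_def)
qed

definition mp_subst :: "(nat \<Rightarrow> 'k::comm_ring_1 mpoly) \<Rightarrow> 'k mpoly \<Rightarrow> 'k mpoly"
  where "mp_subst \<sigma> p =
    (\<Sum>m\<in>Poly_Mapping.keys p. Const (Poly_Mapping.lookup p m) *
      (\<Prod>i\<in>Poly_Mapping.keys m. \<sigma> i ^ Poly_Mapping.lookup m i))"

text \<open>In the partial derivative, the truncated exponent subtraction is harmless: it only takes effect
  when the coefficient is zero.\<close>

definition mp_pderiv :: "nat \<Rightarrow> 'k::comm_ring_1 mpoly \<Rightarrow> 'k mpoly"
  where "mp_pderiv i p =
    (\<Sum>m\<in>Poly_Mapping.keys p. Poly_Mapping.single (m - Poly_Mapping.single i 1)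
      (of_nat (Poly_Mapping.lookup m i) * Poly_Mapping.lookup p m))"

definition Delta_op :: "'k::comm_ring_1 mat \<Rightarrow> nat \<Rightarrow> 'k mpoly \<Rightarrow> 'k mpoly"
  where "Delta_op M i p = mp_subst (\<lambda>j. Var j - Const (M $$ (i, j))) p - p"

definition Delta :: "nat \<Rightarrow> 'k::comm_ring_1 mat \<Rightarrow> 'k mpoly set"
  where "Delta n M = {p \<in> polys n. \<forall>i<n. mp_pderiv i (Delta_op M i p) = 0}"

definition mon_deg :: "(nat \<Rightarrow>\<^sub>0 nat) \<Rightarrow> nat"
  where "mon_deg m = (\<Sum>i\<in>Poly_Mapping.keys m. Poly_Mapping.lookup m i)"

definition homogeneous :: "nat \<Rightarrow> 'k::comm_ring_1 mpoly \<Rightarrow> bool"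
  where "homogeneous d p \<longleftrightarrow> (\<forall>m\<in>Poly_Mapping.keys p. mon_deg m = d)"

definition hom_comp :: "nat \<Rightarrow> 'k::comm_ring_1 mpoly \<Rightarrow> 'k mpoly"
  where "hom_comp d p =
    (\<Sum>m\<in>{m \<in> Poly_Mapping.keys p. mon_deg m = d}. Poly_Mapping.single m (Poly_Mapping.lookup p m))"

definition hom_part :: "'k::comm_ring_1 mpoly set \<Rightarrow> nat \<Rightarrow> 'k mpoly set"
  where "hom_part L d = {p \<in> L. homogeneous d p}"

definition graded_subspace :: "nat \<Rightarrow> 'k::field mpoly set \<Rightarrow> bool"
  where "graded_subspace n L \<longleftrightarrow>
    L \<subseteq> polys n \<and> mp.subspace L \<and> (\<forall>p\<in>L. \<forall>d. hom_comp d p \<in> L)"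

text \<open>The library's \<open>dim\<close> is \<open>0\<close> on infinite-dimensional spaces, so a statement \<open>dim L = k\<close> has to be
  accompanied by finite-dimensionality.\<close>

definition has_dim :: "'k::field mpoly set \<Rightarrow> nat \<Rightarrow> bool"
  where "has_dim L k \<longleftrightarrow> (\<exists>B. finite B \<and> mp.span B = L) \<and> mp.dim L = k"

end

theory Submission
  imports Defs
begin

text \<open>
  Write \<open>D\<^sub>i = \<Sum>\<^sub>j M\<^sub>i\<^sub>j \<partial>\<^sub>j\<close>. Translation by \<open>- M\<^sub>i\<close> is \<open>exp (- D\<^sub>i)\<close> and \<open>D\<^sub>i\<close> is locally nilpotent, so
  \<open>\<partial>\<^sub>i \<Delta>\<^sub>i\<close> is \<open>\<partial>\<^sub>i D\<^sub>i\<close> times an invertible operator: \<open>\<Delta>(M)\<close> is the joint kernel of the quadratic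
  operators \<open>\<partial>\<^sub>i D\<^sub>i\<close>. In terms of the Taylor coefficients \<open>c m = (\<partial>\<^sup>m p)(0)\<close> this says
  \<open>\<Sum>\<^sub>j M\<^sub>i\<^sub>j c(m + e\<^sub>i + e\<^sub>j) = 0\<close> for all \<open>i\<close> and \<open>m\<close>.

  For \<open>F\<^sub>m J = c(m + 1\<^sub>J)\<close> these equations say \<open>F(m + e\<^sub>j) = T\<^sub>j F\<^sub>m\<close>, where \<open>T\<^sub>j f J = f(J \<union> {j})\<close> if
  \<open>j \<notin> J\<close>, and the remaining values are determined by \<open>\<Sum>\<^sub>j M\<^sub>a\<^sub>j T\<^sub>j f J = 0\<close> for \<open>a \<in> J\<close>, a linear system
  with the invertible matrix \<open>M\<^sub>J\<close>. So \<open>c\<close> is determined by its values on squarefree exponents.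
  The operators \<open>T\<^sub>j\<close> commute; hence conversely every choice of values on squarefree exponents extends to
  a solution \<open>c m = (T\<^sup>m f) {}\<close>, which yields a basis indexed by the subsets \<open>K\<close> of \<open>[n]\<close>, with the
  element of index \<open>K\<close> homogeneous of degree \<open>card K\<close>.
\<close>

section \<open>Exponents, derivatives and translations\<close>

definition unit_exp :: "nat \<Rightarrow> nat \<Rightarrow>\<^sub>0 nat"
  where "unit_exp j = Poly_Mapping.single j 1"

lemma lookup_unit_exp: "Poly_Mapping.lookup (unit_exp j) i = (if i = j then 1 else 0)"
  by (simp add: unit_exp_def lookup_single when_def)

lemma lookup_add_unit_exp:
  "Poly_Mapping.lookup (m + unit_exp j) i = Poly_Mapping.lookup m i + (if i = j then 1 else 0)"
  by (simp add: lookup_add lookup_unit_exp)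

lemma exponent_minus_add_unit:
  assumes "Poly_Mapping.lookup m j \<noteq> 0"
  shows "m - unit_exp j + unit_exp j = m"
  using assms
  by (intro poly_mapping_eqI) (auto simp: unit_exp_def lookup_add lookup_minus lookup_single when_def)

lemma keys_add_unit_exp: "Poly_Mapping.keys (m + unit_exp j) = insert j (Poly_Mapping.keys m)"
  by (auto simp: in_keys_iff lookup_add_unit_exp split: if_splits)

lemma mon_deg_add_unit_exp: "mon_deg (m + unit_exp j) = Suc (mon_deg m)"
proof -
  let ?A = "insert j (Poly_Mapping.keys m)"
  have "mon_deg m = (\<Sum>i\<in>?A. Poly_Mapping.lookup m i)"
    unfolding mon_deg_def by (intro sum.mono_neutral_left) (auto simp: in_keys_iff)
  then show ?thesis
    unfolding mon_deg_def keys_add_unit_exp by (simp add: lookup_add_unit_exp sum.distrib)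
qed

lemma exponent_eq_add_unit_exp:
  assumes "j \<in> Poly_Mapping.keys m"
  obtains m' where "m = m' + unit_exp j"
  using exponent_minus_add_unit[of m j] assms by (metis in_keys_iff)

lemma exponent_induct [consumes 1, case_names zero add]:
  assumes "Poly_Mapping.keys m \<subseteq> A" and "P 0"
    and step: "\<And>m j. j \<in> A \<Longrightarrow> Poly_Mapping.keys m \<subseteq> A \<Longrightarrow> P m \<Longrightarrow> P (m + unit_exp j)"
  shows "P m"
  using assms(1)
proof (induction "mon_deg m" arbitrary: m rule: less_induct)
  case less
  show ?case
  proof (cases "m = 0")
    case False
    then obtain j where j: "j \<in> Poly_Mapping.keys m"
      by (metis all_not_in_conv keys_eq_empty)
    then obtain m' where m: "m = m' + unit_exp j"
      by (rule exponent_eq_add_unit_exp)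
    have "mon_deg m' < mon_deg m" "Poly_Mapping.keys m' \<subseteq> A" "j \<in> A"
      using less.prems j unfolding m keys_add_unit_exp mon_deg_add_unit_exp by auto
    then show ?thesis
      using less.hyps step m by blast
  qed (use assms(2) in simp)
qed

section \<open>Coefficients of products, derivatives and substitutions\<close>

lemma poly_eq_sum_single:
  "p = (\<Sum>m\<in>Poly_Mapping.keys p. Poly_Mapping.single m (Poly_Mapping.lookup p m))"
  by (intro poly_mapping_eqI)
    (auto simp: lookup_sum lookup_single when_def in_keys_iff if_distrib cong: if_cong)

lemma lookup_single_mult:
  fixes p :: "'k::comm_ring_1 mpoly"
  shows "Poly_Mapping.lookup (Poly_Mapping.single k c * p) x =
    (\<Sum>l\<in>Poly_Mapping.keys p. if x = k + l then c * Poly_Mapping.lookup p l else 0)"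
  by (subst poly_eq_sum_single[of p], simp only: sum_distrib_left mult_single)
    (auto simp: lookup_sum lookup_single when_def intro!: sum.cong)

lemma lookup_single_mult_add:
  fixes p :: "'k::comm_ring_1 mpoly"
  shows "Poly_Mapping.lookup (Poly_Mapping.single k c * p) (k + m) = c * Poly_Mapping.lookup p m"
  by (auto simp: lookup_single_mult in_keys_iff)

lemma lookup_mp_scale: "Poly_Mapping.lookup (mp_scale c p) m = c * Poly_Mapping.lookup p m"
  using lookup_single_mult_add[of 0 c p m] by (simp add: mp_scale_def Const_def)

lemma lookup_Var_mult_add:
  "Poly_Mapping.lookup (Var j * p) (m + unit_exp j) = Poly_Mapping.lookup p m"
  using lookup_single_mult_add[of "unit_exp j" 1 p m] by (simp add: Var_def unit_exp_def add.commute)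

lemma lookup_Var_mult_0:
  "Poly_Mapping.lookup m j = 0 \<Longrightarrow> Poly_Mapping.lookup (Var j * p) m = 0"
  by (auto simp: Var_def lookup_single_mult lookup_add intro!: sum.neutral)

lemma Var_mult_single: "Var j * Poly_Mapping.single m c = Poly_Mapping.single (m + unit_exp j) c"
  by (simp add: Var_def unit_exp_def mult_single add.commute)

lemma lookup_mp_pderiv:
  "Poly_Mapping.lookup (mp_pderiv i p) m =
    of_nat (Suc (Poly_Mapping.lookup m i)) * Poly_Mapping.lookup p (m + unit_exp i)"
proof -
  have "Poly_Mapping.lookup (mp_pderiv i p) m =
      (\<Sum>k\<in>Poly_Mapping.keys p. of_nat (Poly_Mapping.lookup k i) * Poly_Mapping.lookup p k
        when k - unit_exp i = m)"
    by (simp add: mp_pderiv_def unit_exp_def lookup_sum lookup_single)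
  also have "\<dots> = (\<Sum>k\<in>Poly_Mapping.keys p.
      if k = m + unit_exp i then of_nat (Poly_Mapping.lookup k i) * Poly_Mapping.lookup p k else 0)"
  proof (rule sum.cong[OF refl])
    fix k
    show "(of_nat (Poly_Mapping.lookup k i) * Poly_Mapping.lookup p k when k - unit_exp i = m) =
      (if k = m + unit_exp i then of_nat (Poly_Mapping.lookup k i) * Poly_Mapping.lookup p k else 0)"
      \<comment> \<open>Truncated subtraction fixes \<open>k\<close> when its exponent at
        \<open>i\<close> is 0, but then the factor \<open>of_nat 0\<close> kills the term.\<close>
      using exponent_minus_add_unit[of k i]
      by (cases "Poly_Mapping.lookup k i = 0") (auto simp: when_def)
  qed
  also have "\<dots> = of_nat (Suc (Poly_Mapping.lookup m i)) * Poly_Mapping.lookup p (m + unit_exp i)"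
    by (auto simp: in_keys_iff lookup_add_unit_exp)
  finally show ?thesis .
qed

lemma mp_pderiv_add: "mp_pderiv i (p + q) = mp_pderiv i p + mp_pderiv i q"
  by (intro poly_mapping_eqI) (simp add: lookup_mp_pderiv lookup_add distrib_left)

lemma mp_pderiv_scale: "mp_pderiv i (mp_scale c p) = mp_scale c (mp_pderiv i p)"
  by (intro poly_mapping_eqI) (simp add: lookup_mp_pderiv lookup_mp_scale ac_simps)

lemma mp_pderiv_0 [simp]: "mp_pderiv i 0 = 0"
  by (simp add: mp_pderiv_def)

lemma mp_pderiv_sum: "mp_pderiv i (sum f A) = (\<Sum>a\<in>A. mp_pderiv i (f a))"
  by (induction A rule: infinite_finite_induct) (simp_all add: mp_pderiv_add)

lemma mp_pderiv_commute: "mp_pderiv i (mp_pderiv j p) = mp_pderiv j (mp_pderiv i p)"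
  by (intro poly_mapping_eqI)
    (simp add: lookup_mp_pderiv lookup_add_unit_exp ac_simps)

lemma mp_pderiv_Var_mult:
  "mp_pderiv i (Var j * p) = Var j * mp_pderiv i p + (if i = j then p else 0)"
proof (rule poly_mapping_eqI)
  fix m
  show "Poly_Mapping.lookup (mp_pderiv i (Var j * p)) m =
    Poly_Mapping.lookup (Var j * mp_pderiv i p + (if i = j then p else 0)) m"
  proof (cases "Poly_Mapping.lookup m j = 0")
    case True
    then show ?thesis
      by (cases "i = j")
        (simp_all add: lookup_mp_pderiv lookup_add lookup_Var_mult_0 lookup_Var_mult_add lookup_unit_exp)
  next
    case False
    define m' where "m' = m - unit_exp j"
    have m: "m = m' + unit_exp j"
      unfolding m'_def using False by (simp add: exponent_minus_add_unit)
    have "Poly_Mapping.lookup (Var j * p) (m + unit_exp i) = Poly_Mapping.lookup p (m' + unit_exp i)"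
      using lookup_Var_mult_add[of j p "m' + unit_exp i"] by (simp add: m add.commute add.left_commute)
    moreover have "Poly_Mapping.lookup (Var j * mp_pderiv i p) m =
        of_nat (Suc (Poly_Mapping.lookup m' i)) * Poly_Mapping.lookup p (m' + unit_exp i)"
      unfolding m lookup_Var_mult_add lookup_mp_pderiv ..
    ultimately show ?thesis
      by (cases "i = j")
        (simp_all add: lookup_mp_pderiv lookup_add m lookup_unit_exp algebra_simps)
  qed
qed

text \<open>Monomials grow by one variable at a time, so an additive claim only has to be checked
  under multiplication by \<open>Var j\<close>, where a Leibniz rule is available.\<close>

lemma polys_induct [consumes 1, case_names zero add const Var_mult]:
  assumes "p \<in> polys n" and zero: "P 0"
    and add: "\<And>p q. P p \<Longrightarrow> P q \<Longrightarrow> P (p + q)"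
    and const: "\<And>c. P (Poly_Mapping.single 0 c)"
    and step: "\<And>j m c. j < n \<Longrightarrow> P (Poly_Mapping.single m c) \<Longrightarrow> P (Poly_Mapping.single (m + unit_exp j) c)"
  shows "P p"
proof -
  have single: "P (Poly_Mapping.single m c)" if "Poly_Mapping.keys m \<subseteq> {..<n}" for m c
    using that by (induction rule: exponent_induct) (auto intro: const step)
  have "P (\<Sum>m\<in>A. Poly_Mapping.single m (Poly_Mapping.lookup p m))"
    if "finite A" "\<forall>m\<in>A. Poly_Mapping.keys m \<subseteq> {..<n}" for A
    using that by (induction A rule: finite_induct) (auto intro: zero add single)
  then have "P (\<Sum>m\<in>Poly_Mapping.keys p. Poly_Mapping.single m (Poly_Mapping.lookup p m))"
    using assms(1) by (simp add: polys_def)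
  then show ?thesis
    by (simp flip: poly_eq_sum_single)
qed

text \<open>Allows one common index set for \<open>p\<close>, \<open>q\<close> and
  \<open>p + q\<close>, whose supports differ.\<close>

lemma mp_subst_superset:
  assumes "finite A" "Poly_Mapping.keys p \<subseteq> A"
  shows "mp_subst \<sigma> p = (\<Sum>m\<in>A. Const (Poly_Mapping.lookup p m) *
      (\<Prod>i\<in>Poly_Mapping.keys m. \<sigma> i ^ Poly_Mapping.lookup m i))"
  unfolding mp_subst_def using assms
  by (intro sum.mono_neutral_left) (auto simp: in_keys_iff Const_def)

lemma mp_subst_add: "mp_subst \<sigma> (p + q) = mp_subst \<sigma> p + mp_subst \<sigma> q"
proof -
  let ?A = "Poly_Mapping.keys p \<union> Poly_Mapping.keys q"
  show ?thesis
    using keys_add[of p q]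
    by (simp add: mp_subst_superset[of ?A] lookup_add Const_def single_add distrib_right sum.distrib)
qed

lemma mp_subst_0: "mp_subst \<sigma> 0 = 0"
  by (simp add: mp_subst_def)

lemma mp_subst_single:
  "mp_subst \<sigma> (Poly_Mapping.single m c) =
    Const c * (\<Prod>i\<in>Poly_Mapping.keys m. \<sigma> i ^ Poly_Mapping.lookup m i)"
  by (simp add: mp_subst_def Const_def)

lemma mp_subst_single_add_unit_exp:
  "mp_subst \<sigma> (Poly_Mapping.single (m + unit_exp j) c) = \<sigma> j * mp_subst \<sigma> (Poly_Mapping.single m c)"
proof -
  let ?A = "insert j (Poly_Mapping.keys m)"
  have "(\<Prod>i\<in>Poly_Mapping.keys m. \<sigma> i ^ Poly_Mapping.lookup m i)
      = (\<Prod>i\<in>?A. \<sigma> i ^ Poly_Mapping.lookup m i)"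
    by (intro prod.mono_neutral_left) (auto simp: in_keys_iff)
  moreover have "(\<Prod>i\<in>?A. \<sigma> i ^ Poly_Mapping.lookup (m + unit_exp j) i)
      = \<sigma> j * (\<Prod>i\<in>?A. \<sigma> i ^ Poly_Mapping.lookup m i)"
    by (simp add: lookup_add_unit_exp power_add prod.distrib if_distrib[of "power _"] ac_simps cong: if_cong)
  ultimately show ?thesis
    by (simp add: mp_subst_single keys_add_unit_exp ac_simps)
qed

section \<open>Directional derivatives and translation as their exponential\<close>

definition dir_deriv :: "nat \<Rightarrow> (nat \<Rightarrow> 'k::field) \<Rightarrow> 'k mpoly \<Rightarrow> 'k mpoly"
  where "dir_deriv n v p = (\<Sum>j<n. mp_scale (v j) (mp_pderiv j p))"

lemma dir_deriv_add: "dir_deriv n v (p + q) = dir_deriv n v p + dir_deriv n v q"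
  by (simp add: dir_deriv_def mp_pderiv_add mp.scale_right_distrib sum.distrib)

lemma dir_deriv_scale: "dir_deriv n v (mp_scale c p) = mp_scale c (dir_deriv n v p)"
  by (simp add: dir_deriv_def mp_pderiv_scale mp.scale_sum_right mult.commute)

lemma dir_deriv_0 [simp]: "dir_deriv n v 0 = 0"
  by (simp add: dir_deriv_def)

lemma dir_deriv_pow_0 [simp]: "(dir_deriv n v ^^ k) 0 = 0"
  by (induction k) simp_all

lemma dir_deriv_pow_add: "(dir_deriv n v ^^ k) (p + q) = (dir_deriv n v ^^ k) p + (dir_deriv n v ^^ k) q"
  by (induction k) (simp_all add: dir_deriv_add)

lemma dir_deriv_pow_scale: "(dir_deriv n v ^^ k) (mp_scale c p) = mp_scale c ((dir_deriv n v ^^ k) p)"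
  by (induction k) (simp_all add: dir_deriv_scale)

lemma dir_deriv_pow_sum: "(dir_deriv n v ^^ k) (sum f A) = (\<Sum>a\<in>A. (dir_deriv n v ^^ k) (f a))"
  by (induction A rule: infinite_finite_induct) (simp_all add: dir_deriv_pow_add)

lemma mp_pderiv_dir_deriv: "mp_pderiv i (dir_deriv n v p) = dir_deriv n v (mp_pderiv i p)"
  unfolding dir_deriv_def mp_pderiv_sum mp_pderiv_scale by (subst mp_pderiv_commute) rule

lemma mp_pderiv_dir_deriv_pow:
  "mp_pderiv i ((dir_deriv n v ^^ k) p) = (dir_deriv n v ^^ k) (mp_pderiv i p)"
  by (induction k) (simp_all add: mp_pderiv_dir_deriv)

lemma Var_mult_scale: "Var j * mp_scale c p = mp_scale c (Var j * p)"
  by (simp add: mp_scale_def ac_simps)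

lemma dir_deriv_Var_mult:
  assumes "j < n"
  shows "dir_deriv n v (Var j * p) = Var j * dir_deriv n v p + mp_scale (v j) p"
proof -
  have "(\<Sum>i<n. mp_scale (v i) (if i = j then p else 0)) = mp_scale (v j) p"
    using assms by (simp add: if_distrib cong: if_cong)
  then show ?thesis
    by (simp add: dir_deriv_def mp_pderiv_Var_mult mp.scale_right_distrib sum.distrib
        sum_distrib_left Var_mult_scale)
qed

text \<open>The commutator of D = \<open>dir_deriv n v\<close> with multiplication by x_j is the
  scalar v_j, so that of D^k is k v_j D^(k-1). At k = 0 the truncated \<open>k - 1\<close> is
  harmless, the coefficient being 0.\<close>

lemma dir_deriv_pow_Var_mult:
  assumes "j < n"
  shows "(dir_deriv n v ^^ k) (Var j * p) = Var j * (dir_deriv n v ^^ k) p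
    + mp_scale (of_nat k * v j) ((dir_deriv n v ^^ (k - 1)) p)"
proof (induction k)
  case (Suc k)
  let ?D = "dir_deriv n v"
  have "(?D ^^ Suc k) (Var j * p) = Var j * (?D ^^ Suc k) p
      + (mp_scale (v j) ((?D ^^ k) p) + mp_scale (of_nat k * v j) (?D ((?D ^^ (k - 1)) p)))"
    by (simp add: Suc dir_deriv_add dir_deriv_scale dir_deriv_Var_mult[OF assms])
  also have "mp_scale (of_nat k * v j) (?D ((?D ^^ (k - 1)) p)) = mp_scale (of_nat k * v j) ((?D ^^ k) p)"
    by (cases k) simp_all
  finally show ?case
    by (simp add: mp.scale_left_distrib distrib_right)
qed simp

text \<open>Taylor's formula p(x - v) = exp(-D) p. It is claimed for all \<open>K\<close> beyond a
  bound so that the bounds of two summands can be merged. The commutator rule gives exp(-D)(x_j p) =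
  (x_j - v_j) exp(-D) p.\<close>

lemma translate_eq_exp_dir_deriv:
  fixes p :: "'k::field_char_0 mpoly"
  assumes "p \<in> polys n"
  shows "\<exists>N. \<forall>K\<ge>N. (dir_deriv n v ^^ K) p = 0 \<and>
    mp_subst (\<lambda>j. Var j - Const (v j)) p =
      (\<Sum>k<K. mp_scale ((- 1) ^ k / fact k) ((dir_deriv n v ^^ k) p))"
  using assms
proof (induction rule: polys_induct)
  case zero
  show ?case by (simp add: mp_subst_0)
next
  case (add p q)
  then obtain N1 N2 where N: "\<forall>K\<ge>N1. (dir_deriv n v ^^ K) p = 0 \<and> mp_subst (\<lambda>j. Var j - Const (v j)) p =
      (\<Sum>k<K. mp_scale ((- 1) ^ k / fact k) ((dir_deriv n v ^^ k) p))"
    "\<forall>K\<ge>N2. (dir_deriv n v ^^ K) q = 0 \<and> mp_subst (\<lambda>j. Var j - Const (v j)) q =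
      (\<Sum>k<K. mp_scale ((- 1) ^ k / fact k) ((dir_deriv n v ^^ k) q))"
    by blast
  show ?case
  proof (intro exI[of _ "max N1 N2"] allI impI)
    fix K assume "max N1 N2 \<le> K"
    then show "(dir_deriv n v ^^ K) (p + q) = 0 \<and> mp_subst (\<lambda>j. Var j - Const (v j)) (p + q) =
        (\<Sum>k<K. mp_scale ((- 1) ^ k / fact k) ((dir_deriv n v ^^ k) (p + q)))"
      using N[rule_format, of K]
      by (simp add: dir_deriv_pow_add mp_subst_add mp.scale_right_distrib sum.distrib)
  qed
next
  case (const c)
  have "dir_deriv n v (Poly_Mapping.single 0 c) = 0"
    by (auto simp: dir_deriv_def mp_pderiv_def intro!: sum.neutral)
  then have pow: "(dir_deriv n v ^^ Suc k) (Poly_Mapping.single 0 c) = 0" for k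
    by (simp only: funpow_Suc_right o_apply dir_deriv_pow_0)
  show ?case
  proof (intro exI[of _ 1] allI impI)
    fix K :: nat assume "1 \<le> K"
    then obtain L where K: "K = Suc L" by (cases K) auto
    show "(dir_deriv n v ^^ K) (Poly_Mapping.single 0 c) = 0 \<and>
      mp_subst (\<lambda>j. Var j - Const (v j)) (Poly_Mapping.single 0 c) =
      (\<Sum>k<K. mp_scale ((- 1) ^ k / fact k) ((dir_deriv n v ^^ k) (Poly_Mapping.single 0 c)))"
      unfolding K sum.lessThan_Suc_shift pow by (simp add: mp_subst_single Const_def)
  qed
next
  case (Var_mult j m c)
  let ?D = "dir_deriv n v" and ?p = "Poly_Mapping.single m c"
  let ?S = "mp_subst (\<lambda>j. Var j - Const (v j))" and ?a = "\<lambda>k. (- 1) ^ k / fact k :: 'k"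
  obtain N where N: "\<forall>K\<ge>N. (?D ^^ K) ?p = 0 \<and> ?S ?p = (\<Sum>k<K. mp_scale (?a k) ((?D ^^ k) ?p))"
    using Var_mult.IH by blast
  have nil: "(?D ^^ K) ?p = 0" and exp: "(\<Sum>k<K. mp_scale (?a k) ((?D ^^ k) ?p)) = ?S ?p"
    if "N \<le> K" for K
    using N[rule_format, OF that] by auto
  show ?case
  proof (intro exI[of _ "Suc N"] allI impI conjI)
    fix K assume "Suc N \<le> K"
    then obtain L where K: "K = Suc L" and L: "N \<le> L" by (cases K) auto
    show "(?D ^^ K) (Poly_Mapping.single (m + unit_exp j) c) = 0"
      unfolding Var_mult_single[symmetric] dir_deriv_pow_Var_mult[OF Var_mult.hyps(1)]
      using nil[of K] nil[of L] L by (simp add: K)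
    have coeff: "?a (Suc k) * (of_nat (Suc k) * v j) = - v j * ?a k" for k
      by (simp add: field_simps del: of_nat_Suc)
    have "(\<Sum>k<K. mp_scale (?a k) ((?D ^^ k) (Var j * ?p)))
      = Var j * (\<Sum>k<K. mp_scale (?a k) ((?D ^^ k) ?p))
        + (\<Sum>k<K. mp_scale (?a k * (of_nat k * v j)) ((?D ^^ (k - 1)) ?p))"
      by (simp add: dir_deriv_pow_Var_mult[OF Var_mult.hyps(1)] mp.scale_right_distrib
          sum.distrib sum_distrib_left Var_mult_scale)
    also have "(\<Sum>k<K. mp_scale (?a k) ((?D ^^ k) ?p)) = ?S ?p"
      using L K by (intro exp) auto
    \<comment> \<open>The term k = 0 vanishes; after the index shift \<open>L\<close> terms remain,
      which still suffice because the bound was raised to \<open>Suc N\<close>.\<close>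
    also have "(\<Sum>k<K. mp_scale (?a k * (of_nat k * v j)) ((?D ^^ (k - 1)) ?p))
        = mp_scale (- v j) (\<Sum>k<L. mp_scale (?a k) ((?D ^^ k) ?p))"
      unfolding K sum.lessThan_Suc_shift coeff mp.scale_sum_right by simp
    also have "(\<Sum>k<L. mp_scale (?a k) ((?D ^^ k) ?p)) = ?S ?p"
      using L by (rule exp)
    also have "Var j * ?S ?p + mp_scale (- v j) (?S ?p) = (Var j - Const (v j)) * ?S ?p"
      by (simp add: mp_scale_def Const_def single_uminus left_diff_distrib)
    finally show "?S (Poly_Mapping.single (m + unit_exp j) c) =
        (\<Sum>k<K. mp_scale (?a k) ((?D ^^ k) (Poly_Mapping.single (m + unit_exp j) c)))"
      by (simp add: Var_mult_single mp_subst_single_add_unit_exp)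
  qed
qed

text \<open>If r is nonzero and l is the last exponent with D^l r nonzero, then D^l maps the series
  to b_0 D^l r, which is nonzero.\<close>

lemma nilpotent_series_eq_0_iff:
  assumes nil: "(dir_deriv n v ^^ K) r = 0" and b0: "b 0 \<noteq> 0"
  shows "(\<Sum>k<Suc N. mp_scale (b k) ((dir_deriv n v ^^ k) r)) = 0 \<longleftrightarrow> r = 0"
proof
  let ?D = "dir_deriv n v"
  assume 0: "(\<Sum>k<Suc N. mp_scale (b k) ((?D ^^ k) r)) = 0"
  show "r = 0"
  proof (rule ccontr)
    assume "r \<noteq> 0"
    define L where "L = (LEAST L. (?D ^^ L) r = 0)"
    have L: "(?D ^^ L) r = 0" unfolding L_def using nil by (rule LeastI)
    with \<open>r \<noteq> 0\<close> obtain l where l: "L = Suc l" by (cases L) auto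
    have ne: "(?D ^^ l) r \<noteq> 0" using not_less_Least[of l "\<lambda>L. (?D ^^ L) r = 0"] l unfolding L_def by auto
    have high: "(?D ^^ l) ((?D ^^ Suc k) r) = 0" for k
    proof -
      have "(?D ^^ l) ((?D ^^ Suc k) r) = (?D ^^ (k + L)) r"
        unfolding l by (simp only: funpow_add[THEN fun_cong, unfolded o_apply, symmetric])
          (simp add: ac_simps)
      then show ?thesis by (simp add: funpow_add L)
    qed
    have "(?D ^^ l) (\<Sum>k<Suc N. mp_scale (b k) ((?D ^^ k) r)) = mp_scale (b 0) ((?D ^^ l) r)"
      unfolding dir_deriv_pow_sum dir_deriv_pow_scale unfolding sum.lessThan_Suc_shift high by simp
    then show False using 0 ne b0 by simp
  qed
qed simp

text \<open>exp(-D) - 1 is D times a series in D with constant term -1. The partial derivative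
  commutes with D, and the series is injective on nilpotent elements.\<close>

lemma mp_pderiv_Delta_op_eq_0_iff:
  fixes p :: "'k::field_char_0 mpoly"
  assumes "p \<in> polys n"
  shows "mp_pderiv i (Delta_op M i p) = 0 \<longleftrightarrow>
    dir_deriv n (\<lambda>j. M $$ (i, j)) (mp_pderiv i p) = 0"
proof -
  let ?D = "dir_deriv n (\<lambda>j. M $$ (i, j))" and ?a = "\<lambda>k. (- 1) ^ k / fact k :: 'k"
  obtain N where N: "\<forall>K\<ge>N. (?D ^^ K) p = 0 \<and> mp_subst (\<lambda>j. Var j - Const (M $$ (i, j))) p =
      (\<Sum>k<K. mp_scale (?a k) ((?D ^^ k) p))"
    using translate_eq_exp_dir_deriv[OF assms, of "\<lambda>j. M $$ (i, j)"] by blast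
  have nil: "(?D ^^ K) p = 0" and exp: "mp_subst (\<lambda>j. Var j - Const (M $$ (i, j))) p =
      (\<Sum>k<K. mp_scale (?a k) ((?D ^^ k) p))" if "N \<le> K" for K
    using N[rule_format, OF that] by auto
  \<comment> \<open>Of \<open>Suc (Suc N)\<close> terms of the exponential, the one for k = 0 is
    \<open>p\<close> and cancels.\<close>
  have "Delta_op M i p = (\<Sum>k<Suc N. mp_scale (?a (Suc k)) ((?D ^^ Suc k) p))"
    unfolding Delta_op_def
    by (subst exp[of "Suc (Suc N)"], simp, subst sum.lessThan_Suc_shift, simp)
  then have "mp_pderiv i (Delta_op M i p) =
      (\<Sum>k<Suc N. mp_scale (?a (Suc k)) ((?D ^^ k) (?D (mp_pderiv i p))))"
    by (simp only: mp_pderiv_sum mp_pderiv_scale mp_pderiv_dir_deriv_pow mp_pderiv_dir_deriv funpow_Suc_right o_apply)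
  moreover have "(?D ^^ N) (?D (mp_pderiv i p)) = mp_pderiv i ((?D ^^ Suc N) p)"
    by (simp only: mp_pderiv_dir_deriv_pow mp_pderiv_dir_deriv funpow_Suc_right o_apply)
  then have "(?D ^^ N) (?D (mp_pderiv i p)) = 0"
    using nil[of "Suc N"] by simp
  then have "(\<Sum>k<Suc N. mp_scale (?a (Suc k)) ((?D ^^ k) (?D (mp_pderiv i p)))) = 0
      \<longleftrightarrow> ?D (mp_pderiv i p) = 0"
    by (rule nilpotent_series_eq_0_iff) simp
  ultimately show ?thesis
    by (simp only:)
qed

section \<open>Taylor coefficients\<close>

text \<open>Ensures finite support for the basis elements, whose coefficients are prescribed in a
  single degree.\<close>

lemma finite_exponents_of_degree:
  "finite {m. Poly_Mapping.keys m \<subseteq> {..<n} \<and> mon_deg m = d}"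
proof (induction d)
  case 0
  have "m = 0" if "mon_deg m = 0" for m
    using that by (auto simp: mon_deg_def in_keys_iff intro!: poly_mapping_eqI)
  then have "{m. Poly_Mapping.keys m \<subseteq> {..<n} \<and> mon_deg m = 0} \<subseteq> {0}"
    by blast
  then show ?case
    by (rule finite_subset) simp
next
  case (Suc d)
  let ?S = "\<lambda>d. {m. Poly_Mapping.keys m \<subseteq> {..<n} \<and> mon_deg m = d}"
  have "?S (Suc d) \<subseteq> (\<Union>j<n. (\<lambda>m. m + unit_exp j) ` ?S d)"
  proof
    fix m assume m: "m \<in> ?S (Suc d)"
    then have "m \<noteq> 0" by (auto simp: mon_deg_def)
    then obtain j where j: "j \<in> Poly_Mapping.keys m"
      by (metis all_not_in_conv keys_eq_empty)
    then obtain m' where m': "m = m' + unit_exp j"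
      by (rule exponent_eq_add_unit_exp)
    have "m' \<in> ?S d" "j < n"
      using m j unfolding m' by (auto simp: keys_add_unit_exp mon_deg_add_unit_exp)
    then show "m \<in> (\<Union>j<n. (\<lambda>m. m + unit_exp j) ` ?S d)"
      using m' by blast
  qed
  then show ?case
    by (rule finite_subset) (use Suc in auto)
qed

definition indicator_exp :: "nat set \<Rightarrow> nat \<Rightarrow>\<^sub>0 nat"
  where "indicator_exp J = (\<Sum>j\<in>J. unit_exp j)"

lemma indicator_exp_empty [simp]: "indicator_exp {} = 0"
  by (simp add: indicator_exp_def)

lemma indicator_exp_insert:
  "finite J \<Longrightarrow> j \<notin> J \<Longrightarrow> indicator_exp (insert j J) = indicator_exp J + unit_exp j"
  by (simp add: indicator_exp_def add.commute)

lemma mon_deg_indicator_exp: "finite J \<Longrightarrow> mon_deg (indicator_exp J) = card J"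
  by (induction J rule: finite_induct)
    (simp_all add: indicator_exp_insert mon_deg_add_unit_exp, simp add: mon_deg_def)

lemma keys_indicator_exp: "finite J \<Longrightarrow> Poly_Mapping.keys (indicator_exp J) = J"
  by (induction J rule: finite_induct) (simp_all add: indicator_exp_insert keys_add_unit_exp)

definition exp_fact :: "(nat \<Rightarrow>\<^sub>0 nat) \<Rightarrow> 'k::field_char_0"
  where "exp_fact m = (\<Prod>i\<in>Poly_Mapping.keys m. fact (Poly_Mapping.lookup m i))"

lemma exp_fact_nonzero [simp]: "exp_fact m \<noteq> 0"
  by (simp add: exp_fact_def)

lemma exp_fact_add_unit_exp:
  "exp_fact (m + unit_exp j) = of_nat (Suc (Poly_Mapping.lookup m j)) * exp_fact m"
proof -
  define K where "K = Poly_Mapping.keys m - {j}"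
  have K: "finite K" "j \<notin> K" "insert j (Poly_Mapping.keys m) = insert j K"
    by (auto simp: K_def)
  have "exp_fact m = (\<Prod>i\<in>insert j K. fact (Poly_Mapping.lookup m i) :: 'a)"
    unfolding exp_fact_def by (intro prod.mono_neutral_left) (auto simp: K_def in_keys_iff)
  moreover have "exp_fact (m + unit_exp j)
      = (\<Prod>i\<in>insert j K. fact (Poly_Mapping.lookup (m + unit_exp j) i) :: 'a)"
    unfolding exp_fact_def keys_add_unit_exp K(3) ..
  moreover have "(\<Prod>i\<in>K. fact (Poly_Mapping.lookup (m + unit_exp j) i) :: 'a)
      = (\<Prod>i\<in>K. fact (Poly_Mapping.lookup m i))"
    using K(2) by (intro prod.cong) (auto simp: lookup_add_unit_exp)
  ultimately show ?thesis
    using K(1,2) by (simp add: lookup_add_unit_exp)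
qed

text \<open>In these coordinates differentiation is an index shift without numerical factor; in
  characteristic 0 they determine \<open>p\<close>.\<close>

definition taylor_coeff :: "'k::field_char_0 mpoly \<Rightarrow> (nat \<Rightarrow>\<^sub>0 nat) \<Rightarrow> 'k"
  where "taylor_coeff p m = exp_fact m * Poly_Mapping.lookup p m"

lemma taylor_coeff_eq_0_iff: "taylor_coeff p m = 0 \<longleftrightarrow> m \<notin> Poly_Mapping.keys p"
  by (simp add: taylor_coeff_def in_keys_iff)

lemma poly_eqI_taylor_coeff: "(\<And>m. taylor_coeff p m = taylor_coeff q m) \<Longrightarrow> p = q"
  by (intro poly_mapping_eqI) (simp add: taylor_coeff_def)

lemma taylor_coeff_0 [simp]: "taylor_coeff 0 m = 0"
  by (simp add: taylor_coeff_def)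

lemma taylor_coeff_add: "taylor_coeff (p + q) m = taylor_coeff p m + taylor_coeff q m"
  by (simp add: taylor_coeff_def lookup_add distrib_left)

lemma taylor_coeff_minus: "taylor_coeff (p - q) m = taylor_coeff p m - taylor_coeff q m"
  by (simp add: taylor_coeff_def lookup_minus right_diff_distrib)

lemma taylor_coeff_scale: "taylor_coeff (mp_scale c p) m = c * taylor_coeff p m"
  by (simp add: taylor_coeff_def lookup_mp_scale ac_simps)

lemma taylor_coeff_sum: "taylor_coeff (sum f A) m = (\<Sum>a\<in>A. taylor_coeff (f a) m)"
  by (induction A rule: infinite_finite_induct) (simp_all add: taylor_coeff_add)

lemma taylor_coeff_mp_pderiv: "taylor_coeff (mp_pderiv j p) m = taylor_coeff p (m + unit_exp j)"
  by (simp only: taylor_coeff_def lookup_mp_pderiv exp_fact_add_unit_exp ac_simps)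

lemma taylor_coeff_dir_deriv:
  "taylor_coeff (dir_deriv n v p) m = (\<Sum>j<n. v j * taylor_coeff p (m + unit_exp j))"
  by (simp add: dir_deriv_def taylor_coeff_sum taylor_coeff_scale taylor_coeff_mp_pderiv)

lemma lookup_hom_comp:
  "Poly_Mapping.lookup (hom_comp d p) m = (if mon_deg m = d then Poly_Mapping.lookup p m else 0)"
  by (auto simp: hom_comp_def lookup_sum lookup_single when_def in_keys_iff if_distrib cong: if_cong)

lemma taylor_coeff_hom_comp:
  "taylor_coeff (hom_comp d p) m = (if mon_deg m = d then taylor_coeff p m else 0)"
  by (simp add: taylor_coeff_def lookup_hom_comp)

lemma polys_iff_taylor_coeff:
  "p \<in> polys n \<longleftrightarrow> (\<forall>m. \<not> Poly_Mapping.keys m \<subseteq> {..<n} \<longrightarrow> taylor_coeff p m = 0)"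
  by (auto simp: polys_def taylor_coeff_eq_0_iff)

lemma homogeneous_iff_taylor_coeff:
  "homogeneous d p \<longleftrightarrow> (\<forall>m. mon_deg m \<noteq> d \<longrightarrow> taylor_coeff p m = 0)"
  by (auto simp: homogeneous_def taylor_coeff_eq_0_iff)

text \<open>The terminology is Macaulay's: these polynomials are annihilated by the ideal of the quadrics
  \<open>y\<^sub>i \<Sum>\<^sub>j M\<^sub>i\<^sub>j y\<^sub>j\<close>, with \<open>y\<^sub>i\<close> acting as \<open>\<partial>\<^sub>i\<close>.\<close>

definition inverse_system :: "nat \<Rightarrow> (nat \<Rightarrow> nat \<Rightarrow> 'k::field_char_0) \<Rightarrow> 'k mpoly set" where
  "inverse_system n M = {p \<in> polys n. \<forall>i<n. \<forall>m.
    (\<Sum>j<n. M i j * taylor_coeff p (m + unit_exp j + unit_exp i)) = 0}"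

lemma Delta_eq_inverse_system:
  fixes M :: "'k::field_char_0 mat"
  shows "Delta n M = inverse_system n (\<lambda>i j. M $$ (i, j))"
proof -
  have "mp_pderiv i (Delta_op M i p) = 0 \<longleftrightarrow>
      (\<forall>m. (\<Sum>j<n. M $$ (i, j) * taylor_coeff p (m + unit_exp j + unit_exp i)) = 0)"
    if "p \<in> polys n" for p i
  proof -
    have "mp_pderiv i (Delta_op M i p) = 0 \<longleftrightarrow>
        (\<forall>m. taylor_coeff (dir_deriv n (\<lambda>j. M $$ (i, j)) (mp_pderiv i p)) m = 0)"
      unfolding mp_pderiv_Delta_op_eq_0_iff[OF that]
      using poly_eqI_taylor_coeff[of _ 0] by auto
    then show ?thesis
      by (simp add: taylor_coeff_dir_deriv taylor_coeff_mp_pderiv)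
  qed
  then show ?thesis
    unfolding Delta_def inverse_system_def by auto
qed

lemma subspace_inverse_system: "mp.subspace (inverse_system n M)"
proof (rule mp.subspaceI)
  show "0 \<in> inverse_system n M"
    by (simp add: inverse_system_def polys_iff_taylor_coeff)
next
  fix p q assume "p \<in> inverse_system n M" "q \<in> inverse_system n M"
  then show "p + q \<in> inverse_system n M"
    by (simp add: inverse_system_def polys_iff_taylor_coeff taylor_coeff_add distrib_left sum.distrib)
next
  fix c p assume "p \<in> inverse_system n M"
  then show "mp_scale c p \<in> inverse_system n M"
    by (simp add: inverse_system_def polys_iff_taylor_coeff taylor_coeff_scale mult.left_commute
        flip: sum_distrib_left)
qed

text \<open>Each defining equation involves coefficients of the single degree
  \<open>mon_deg m + 2\<close> only.\<close>

lemma hom_comp_inverse_system: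
  assumes "p \<in> inverse_system n M"
  shows "hom_comp d p \<in> inverse_system n M"
proof -
  have "(\<Sum>j<n. M i j * taylor_coeff (hom_comp d p) (m + unit_exp j + unit_exp i)) = 0"
    if "i < n" for i m
    using assms that
    by (cases "d = Suc (Suc (mon_deg m))")
      (simp_all add: inverse_system_def taylor_coeff_hom_comp mon_deg_add_unit_exp)
  then show ?thesis
    using assms by (simp add: inverse_system_def polys_iff_taylor_coeff taylor_coeff_hom_comp)
qed

lemma subspace_hom_part:
  fixes L :: "'k::field_char_0 mpoly set"
  assumes "mp.subspace L"
  shows "mp.subspace (hom_part L d)"
  using assms
  by (simp add: mp.subspace_def hom_part_def homogeneous_iff_taylor_coeff taylor_coeff_add
      taylor_coeff_scale)

section \<open>Commuting shift operators on set functions\<close>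

text \<open>Rows and columns are indexed by the elements of \<open>J\<close> themselves, which
  confines renumbering to the next lemma.\<close>

definition inverse_on :: "'i set \<Rightarrow> ('i \<Rightarrow> 'i \<Rightarrow> 'k::comm_ring_1) \<Rightarrow> ('i \<Rightarrow> 'i \<Rightarrow> 'k) \<Rightarrow> bool" where
  "inverse_on J M N \<longleftrightarrow> (\<forall>j\<in>J. \<forall>k\<in>J.
    (\<Sum>a\<in>J. N j a * M a k) = (if j = k then 1 else 0) \<and>
    (\<Sum>a\<in>J. M j a * N a k) = (if j = k then 1 else 0))"

lemma submatrix_inverse:
  fixes M :: "'k::field mat"
  assumes M: "M \<in> carrier_mat n n" and J: "J \<subseteq> {..<n}" and det: "det (submatrix M J J) \<noteq> 0"
  shows "\<exists>N. inverse_on J (\<lambda>i j. M $$ (i, j)) N"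
proof -
  define c where "c = card J"
  have fin: "finite J" using J finite_subset by blast
  have Jn: "{i. i < n \<and> i \<in> J} = J" using J by auto
  define A where "A = submatrix M J J"
  have A: "A \<in> carrier_mat c c"
    using M by (auto simp: A_def c_def dim_submatrix Jn intro!: carrier_matI)
  obtain B where B: "B \<in> carrier_mat c c" and BA: "B * A = 1\<^sub>m c" and AB: "A * B = 1\<^sub>m c"
    using det_non_zero_imp_unit[OF A det[folded A_def], unfolded Units_def, of "()"]
    by (auto simp: ring_mat_def)
  \<comment> \<open>\<open>r j\<close> is the position of \<open>j\<close> in the increasing
    enumeration \<open>pick J\<close>; it transports matrix entries back to indices in
    \<open>J\<close>.\<close>
  define r where "r j = card {a \<in> J. a < j}" for j
  have r_less: "r j < c" if "j \<in> J" for j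
    unfolding r_def c_def using that fin by (intro psubset_card_mono) auto
  have pick_r: "pick J (r j) = j" if "j \<in> J" for j
    unfolding r_def using that by (rule pick_card_in_set)
  have bij: "bij_betw r J {..<c}"
  proof (rule bij_betw_byWitness[where f' = "pick J"])
    show "\<forall>a\<in>J. pick J (r a) = a" using pick_r by blast
    show "\<forall>i\<in>{..<c}. r (pick J i) = i"
      by (auto simp: r_def c_def intro: card_pick_le)
    show "r ` J \<subseteq> {..<c}" using r_less by auto
    show "pick J ` {..<c} \<subseteq> J" by (auto simp: c_def intro: pick_in_set_le)
  qed
  have A_r: "A $$ (r j, r k) = M $$ (j, k)" if "j \<in> J" "k \<in> J" for j k
    unfolding A_def r_def using that J M by (intro submatrix_index_card) auto
  have r_eq: "r j = r k \<longleftrightarrow> j = k" if "j \<in> J" "k \<in> J" for j k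
    using that bij by (auto simp: bij_betw_def inj_on_def)
  define N where "N j a = B $$ (r j, r a)" for j a
  have "(\<Sum>a\<in>J. N j a * M $$ (a, k)) = (if j = k then 1 else 0)" if jk: "j \<in> J" "k \<in> J" for j k
  proof -
    have "(\<Sum>a\<in>J. N j a * M $$ (a, k)) = (\<Sum>a\<in>J. B $$ (r j, r a) * A $$ (r a, r k))"
      using jk by (simp add: N_def A_r)
    also have "\<dots> = (\<Sum>i<c. B $$ (r j, i) * A $$ (i, r k))"
      by (rule sum.reindex_bij_betw[OF bij])
    also have "\<dots> = (B * A) $$ (r j, r k)"
      using A B jk r_less by (simp add: scalar_prod_def atLeast0LessThan)
    finally show ?thesis using jk r_less by (simp add: BA r_eq)
  qed
  moreover have "(\<Sum>a\<in>J. M $$ (j, a) * N a k) = (if j = k then 1 else 0)"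
    if jk: "j \<in> J" "k \<in> J" for j k
  proof -
    have "(\<Sum>a\<in>J. M $$ (j, a) * N a k) = (\<Sum>a\<in>J. A $$ (r j, r a) * B $$ (r a, r k))"
      using jk by (simp add: N_def A_r)
    also have "\<dots> = (\<Sum>i<c. A $$ (r j, i) * B $$ (i, r k))"
      by (rule sum.reindex_bij_betw[OF bij])
    also have "\<dots> = (A * B) $$ (r j, r k)"
      using A B jk r_less by (simp add: scalar_prod_def atLeast0LessThan)
    finally show ?thesis using jk r_less by (simp add: AB r_eq)
  qed
  ultimately have "inverse_on J (\<lambda>i j. M $$ (i, j)) N"
    by (simp add: inverse_on_def)
  then show ?thesis by (intro exI)
qed

section \<open>Shift operators built from the inverses of the principal submatrices\<close>

locale principal_inverses =
  fixes n :: nat and M :: "nat \<Rightarrow> nat \<Rightarrow> 'k::field" and N :: "nat set \<Rightarrow> nat \<Rightarrow> nat \<Rightarrow> 'k"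
  assumes inverse_on: "J \<subseteq> {..<n} \<Longrightarrow> inverse_on J M (N J)"
begin

lemma left_inv:
  "\<lbrakk>J \<subseteq> {..<n}; j \<in> J; k \<in> J\<rbrakk> \<Longrightarrow> (\<Sum>a\<in>J. N J j a * M a k) = (if j = k then 1 else 0)"
  using inverse_on by (simp add: inverse_on_def)

lemma right_inv:
  "\<lbrakk>J \<subseteq> {..<n}; j \<in> J; k \<in> J\<rbrakk> \<Longrightarrow> (\<Sum>a\<in>J. M j a * N J a k) = (if j = k then 1 else 0)"
  using inverse_on by (simp add: inverse_on_def)

text \<open>The value \<open>0\<close> outside the subsets of \<open>{..<n}\<close> makes the operators commute as total functions.\<close>

definition T :: "nat \<Rightarrow> (nat set \<Rightarrow> 'k) \<Rightarrow> nat set \<Rightarrow> 'k" where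
  "T j f J =
    (if J \<subseteq> {..<n} then
       if j \<in> J then - (\<Sum>a\<in>J. N J j a * (\<Sum>k\<in>{..<n} - J. M a k * f (insert k J)))
       else f (insert j J)
     else 0)"

lemma T_notin: "J \<subseteq> {..<n} \<Longrightarrow> j \<notin> J \<Longrightarrow> T j f J = f (insert j J)"
  by (simp add: T_def)

text \<open>The difference w of the two solutions vanishes outside \<open>J\<close>, so M_J
  annihilates its restriction to \<open>J\<close>; the left inverse \<open>N J\<close> then gives w
  = 0.\<close>

lemma solve_unique:
  assumes J: "J \<subseteq> {..<n}"
    and eq: "\<And>a. a \<in> J \<Longrightarrow> (\<Sum>j<n. M a j * u j) = (\<Sum>j<n. M a j * v j)"
    and out: "\<And>j. j < n \<Longrightarrow> j \<notin> J \<Longrightarrow> u j = v j" and j: "j < n"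
  shows "u j = v j"
proof (cases "j \<in> J")
  case True
  have fin: "finite J" using J finite_subset by blast
  define w where "w j = u j - v j" for j
  have w0: "(\<Sum>k\<in>J. M a k * w k) = 0" if "a \<in> J" for a
  proof -
    have "(\<Sum>k\<in>J. M a k * w k) = (\<Sum>k<n. M a k * w k)"
      using J out by (intro sum.mono_neutral_left) (auto simp: w_def)
    also have "\<dots> = 0"
      using eq[OF that] by (simp add: w_def right_diff_distrib sum_subtractf)
    finally show ?thesis .
  qed
  have "w j = (\<Sum>k\<in>J. (if j = k then 1 else 0) * w k)"
    using True fin by (simp add: if_distrib[of "\<lambda>x. x * _"] cong: if_cong)
  also have "\<dots> = (\<Sum>k\<in>J. (\<Sum>a\<in>J. N J j a * M a k) * w k)"
    using J True by (intro sum.cong) (auto simp: left_inv)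
  also have "\<dots> = (\<Sum>k\<in>J. \<Sum>a\<in>J. N J j a * (M a k * w k))"
    by (simp add: sum_distrib_right mult.assoc)
  also have "\<dots> = (\<Sum>a\<in>J. N J j a * (\<Sum>k\<in>J. M a k * w k))"
    by (subst sum.swap) (simp add: sum_distrib_left)
  also have "\<dots> = 0" by (simp add: w0)
  finally show ?thesis by (simp add: w_def)
qed (use out j in auto)

text \<open>On \<open>J\<close> the values of \<open>T\<close> are the inverse of M_J applied to
  minus the contribution of the indices outside \<open>J\<close>.\<close>

lemma sum_T_eq_0:
  assumes J: "J \<subseteq> {..<n}" and a: "a \<in> J"
  shows "(\<Sum>j<n. M a j * T j f J) = 0"
proof -
  have fin: "finite J" using J finite_subset by blast
  define s where "s b = (\<Sum>k\<in>{..<n} - J. M b k * f (insert k J))" for b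
  have "(\<Sum>j\<in>J. M a j * T j f J) = - (\<Sum>j\<in>J. \<Sum>b\<in>J. M a j * (N J j b * s b))"
    using J by (simp add: T_def s_def sum_negf sum_distrib_left)
  also have "\<dots> = - (\<Sum>b\<in>J. (\<Sum>j\<in>J. M a j * N J j b) * s b)"
    by (subst sum.swap) (simp add: sum_distrib_right mult.assoc)
  also have "\<dots> = - (\<Sum>b\<in>J. (if a = b then 1 else 0) * s b)"
    using J a by (simp add: right_inv)
  also have "\<dots> = - s a"
    using a fin by (simp add: if_distrib[of "\<lambda>x. x * _"] cong: if_cong)
  finally have "(\<Sum>j\<in>J. M a j * T j f J) = - s a" .
  moreover have "(\<Sum>j\<in>{..<n} - J. M a j * T j f J) = s a"
    using J by (auto simp: s_def T_notin intro: sum.cong)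
  ultimately show ?thesis
    using sum.subset_diff[OF J, of "\<lambda>j. M a j * T j f J"] by simp
qed

lemma T_unique:
  assumes "J \<subseteq> {..<n}" "j < n"
    and "\<And>a. a \<in> J \<Longrightarrow> (\<Sum>j<n. M a j * u j) = 0"
    and "\<And>j. j < n \<Longrightarrow> j \<notin> J \<Longrightarrow> u j = f (insert j J)"
  shows "u j = T j f J"
  by (rule solve_unique[of J u "\<lambda>j. T j f J"]) (use assms in \<open>auto simp: sum_T_eq_0 T_notin\<close>)

lemma T_sum: "T i (\<lambda>K. \<Sum>j\<in>A. c j * g j K) J = (\<Sum>j\<in>A. c j * T i (g j) J)"
proof -
  have "(\<Sum>a\<in>J. N J i a * (\<Sum>k\<in>{..<n} - J. M a k * (\<Sum>j\<in>A. c j * g j (insert k J))))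
      = (\<Sum>a\<in>J. \<Sum>j\<in>A. \<Sum>k\<in>{..<n} - J. c j * (N J i a * (M a k * g j (insert k J))))"
    unfolding sum_distrib_left
    by (rule sum.cong[OF refl], rule trans[OF sum.swap]) (simp add: ac_simps)
  also have "\<dots> = (\<Sum>j\<in>A. c j * (\<Sum>a\<in>J. N J i a * (\<Sum>k\<in>{..<n} - J. M a k * g j (insert k J))))"
    by (rule trans[OF sum.swap]) (simp add: sum_distrib_left)
  finally have "(\<Sum>a\<in>J. N J i a * (\<Sum>k\<in>{..<n} - J. M a k * (\<Sum>j\<in>A. c j * g j (insert k J))))
      = (\<Sum>j\<in>A. c j * (\<Sum>a\<in>J. N J i a * (\<Sum>k\<in>{..<n} - J. M a k * g j (insert k J))))" .
  then show ?thesis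
    by (simp add: T_def sum_negf)
qed

text \<open>\<open>T i g J\<close> only uses values of \<open>g\<close> on sets with one element
  more than \<open>J\<close>, also when \<open>i\<close> lies in \<open>J\<close>.\<close>

lemma T_eq_0:
  assumes "i < n" "\<And>K. K \<subseteq> {..<n} \<Longrightarrow> J \<subset> K \<Longrightarrow> g K = 0"
  shows "T i g J = 0"
proof (cases "J \<subseteq> {..<n}")
  case True
  have "g (insert k J) = 0" if "k < n" "k \<notin> J" for k
    using assms(2)[of "insert k J"] that True by auto
  then show ?thesis
    using assms(1) True by (auto simp: T_def intro!: sum.neutral)
qed (simp add: T_def)

lemma T_commute:
  assumes i: "i < n" and j: "j < n"
  shows "T i (T j f) = T j (T i f)"
proof
  fix J
  show "T i (T j f) J = T j (T i f) J"
  proof (cases "J \<subseteq> {..<n}")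
    case J: True
    \<comment> \<open>Both sides solve the same linear system in j, so it suffices to compare them for j outside J.\<close>
    have reduce: "T i (T j f) J = T j (T i f) J"
      if i: "i < n" and j: "j < n"
        and out: "\<And>j. j < n \<Longrightarrow> j \<notin> J \<Longrightarrow> T i (T j f) J = T j (T i f) J" for i j
    proof (rule solve_unique[where u = "\<lambda>j. T i (T j f) J", OF J _ out j])
      fix a assume a: "a \<in> J"
      have "(\<Sum>j<n. M a j * T i (T j f) J) = T i (\<lambda>K. \<Sum>j<n. M a j * T j f K) J"
        by (rule T_sum[symmetric])
      \<comment> \<open>\<open>T i\<close> at \<open>J\<close> only sees supersets \<open>K\<close>
        of \<open>J\<close>; as \<open>a\<close> lies in \<open>K\<close>, the inner sum vanishes
        there.\<close>
      also have "\<dots> = 0"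
        using i a by (intro T_eq_0 sum_T_eq_0) auto
      also have "\<dots> = (\<Sum>j<n. M a j * T j (T i f) J)"
        using J a by (simp add: sum_T_eq_0)
      finally show "(\<Sum>j<n. M a j * T i (T j f) J) = (\<Sum>j<n. M a j * T j (T i f) J)" .
    qed
    \<comment> \<open>With both indices outside \<open>J\<close>, either order just inserts both;
      \<open>reduce\<close> then admits every \<open>j\<close>.\<close>
    have notin: "T i (T j f) J = T j (T i f) J" if "i < n" "i \<notin> J" "j < n" for i j
    proof (rule reduce)
      fix j assume "j < n" "j \<notin> J"
      then show "T i (T j f) J = T j (T i f) J"
        using that J by (cases "i = j") (auto simp: T_notin insert_commute)
    qed (use that in auto)
    show ?thesis
      \<comment> \<open>\<open>notin\<close> with the indices exchanged covers \<open>j\<close>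
        outside \<open>J\<close>, so \<open>reduce\<close> now admits every \<open>i\<close> as
        well.\<close>
      by (rule reduce[OF i j]) (use notin i in metis)
  qed (simp add: T_def)
qed

text \<open>Each application lowers the cardinality of supporting sets by one; \<open>d\<close>
  counts earlier applications, \<open>e\<close> is the initial cardinality.\<close>

lemma T_supp_card:
  assumes "i < n" "\<And>J. f J \<noteq> 0 \<Longrightarrow> J \<subseteq> {..<n} \<and> card J + d = e" "T i f J \<noteq> 0"
  shows "J \<subseteq> {..<n} \<and> card J + Suc d = e"
proof -
  have J: "J \<subseteq> {..<n}" using assms(3) by (auto simp: T_def split: if_splits)
  then have fin: "finite J" using finite_subset by blast
  have "card J + Suc d = e"
  proof (rule ccontr)
    assume ne: "card J + Suc d \<noteq> e"
    have "f (insert k J) = 0" if "k \<notin> J" for k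
      using assms(2)[of "insert k J"] ne that fin by auto
    then have "T i f J = 0" by (auto simp: T_def intro!: sum.neutral)
    with assms(3) show False by blast
  qed
  with J show ?thesis by blast
qed

text \<open>The monomial \<open>T\<^sup>m\<close>, restricted to the first \<open>k\<close> indices
  and with its factors in a fixed order, to permit induction on \<open>k\<close>.\<close>

primrec Tpow :: "nat \<Rightarrow> (nat \<Rightarrow>\<^sub>0 nat) \<Rightarrow> (nat set \<Rightarrow> 'k) \<Rightarrow> nat set \<Rightarrow> 'k" where
  "Tpow 0 m f = f"
| "Tpow (Suc k) m f = (T k ^^ Poly_Mapping.lookup m k) (Tpow k m f)"

lemma T_funpow_commute:
  assumes "i < n" "j < n"
  shows "T i ((T j ^^ e) f) = (T j ^^ e) (T i f)"
  by (induction e) (simp_all add: T_commute[OF assms])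

text \<open>Commutativity moves the additional factor \<open>T j\<close> to the outside.\<close>

lemma Tpow_add_single:
  assumes "j < n" "k \<le> n"
  shows "Tpow k (m + unit_exp j) f = (if j < k then T j (Tpow k m f) else Tpow k m f)"
  using assms(2)
proof (induction k)
  case (Suc k)
  then show ?case
    using assms(1)
    by (cases "j = k")
      (auto simp: lookup_add_unit_exp T_funpow_commute when_def less_Suc_eq)
qed simp

lemma Tpow_zero_exp: "Tpow k 0 f = f"
  by (induction k) simp_all

lemma T_funpow_supp_card:
  assumes "i < n" "\<And>J. f J \<noteq> 0 \<Longrightarrow> J \<subseteq> {..<n} \<and> card J + d = e" "(T i ^^ r) f J \<noteq> 0"
  shows "J \<subseteq> {..<n} \<and> card J + (d + r) = e"
  using assms(3)
proof (induction r arbitrary: J)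
  case 0
  then show ?case using assms(2) by simp
next
  case (Suc r)
  show ?case
    using T_supp_card[OF assms(1) Suc.IH] Suc.prems by simp
qed

lemma Tpow_supp_card:
  assumes "k \<le> n" "\<And>J. f J \<noteq> 0 \<Longrightarrow> J \<subseteq> {..<n} \<and> card J = e" "Tpow k m f J \<noteq> 0"
  shows "J \<subseteq> {..<n} \<and> card J + (\<Sum>i<k. Poly_Mapping.lookup m i) = e"
  using assms(1,3)
proof (induction k arbitrary: J)
  case 0
  then show ?case using assms(2) by simp
next
  case (Suc k)
  show ?case
    using T_funpow_supp_card[OF _ Suc.IH, where i = k and r = "Poly_Mapping.lookup m k" and J = J] Suc.prems by simp
qed

text \<open>Every factor \<open>T j\<close> meets a set without \<open>j\<close>, so it merely
  inserts \<open>j\<close>.\<close>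

lemma Tpow_indicator_exp:
  assumes "finite J" "J \<subseteq> {..<n}" "J' \<subseteq> {..<n}" "J \<inter> J' = {}"
  shows "Tpow n (indicator_exp J) f J' = f (J \<union> J')"
  using assms
proof (induction J arbitrary: J' rule: finite_induct)
  case (insert j J)
  then have "Tpow n (indicator_exp (insert j J)) f J' = T j (Tpow n (indicator_exp J) f) J'"
    by (simp add: indicator_exp_insert Tpow_add_single)
  also have "\<dots> = Tpow n (indicator_exp J) f (insert j J')"
    using insert.prems by (intro T_notin) auto
  also have "\<dots> = f (J \<union> insert j J')"
    using insert.prems insert.hyps by (intro insert.IH) auto
  finally show ?case by simp
qed (simp add: Tpow_zero_exp)

end

section \<open>The basis of the inverse system\<close>

locale principal_inverses_char_0 = principal_inverses n M N
  for n and M :: "nat \<Rightarrow> nat \<Rightarrow> 'k::field_char_0" and N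
begin

lemma inverse_system_eq_0I:
  assumes p: "p \<in> inverse_system n M"
    and init: "\<And>J. J \<subseteq> {..<n} \<Longrightarrow> taylor_coeff p (indicator_exp J) = 0"
  shows "p = 0"
proof -
  \<comment> \<open>Squarefree shifts of arbitrary exponents are treated together, so that raising
    \<open>m\<close> by a unit becomes an application of \<open>T j\<close>.\<close>
  have shifted: "\<forall>J. J \<subseteq> {..<n} \<longrightarrow> taylor_coeff p (m + indicator_exp J) = 0"
    if "Poly_Mapping.keys m \<subseteq> {..<n}" for m
    using that
  proof (induction rule: exponent_induct)
    case zero
    show ?case using init by simp
  next
    case (add m j)
    show ?case
    proof (intro allI impI)
      fix J assume J: "J \<subseteq> {..<n}"
      have fin: "finite J" using J finite_subset by blast
      define u where "u j = taylor_coeff p (m + unit_exp j + indicator_exp J)" for j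
      define f where "f K = taylor_coeff p (m + indicator_exp K)" for K
      have "u j = T j f J"
      proof (rule T_unique[OF J])
        show "j < n" using add.hyps by simp
      next
        fix a assume a: "a \<in> J"
        \<comment> \<open>As \<open>a\<close> lies in \<open>J\<close>, its unit splits off, and
          equation \<open>a\<close> of the inverse system at
          \<open>m + indicator_exp (J - {a})\<close> becomes an equation of the linear
          system.\<close>
        then have "indicator_exp J = indicator_exp (J - {a}) + unit_exp a"
          using indicator_exp_insert[of "J - {a}" a] fin by (simp add: insert_absorb)
        then have "u j = taylor_coeff p (m + indicator_exp (J - {a}) + unit_exp j + unit_exp a)" for j
          by (simp add: u_def ac_simps)
        then show "(\<Sum>j<n. M a j * u j) = 0"
          using p J a by (auto simp: inverse_system_def)
      next
        fix j assume "j \<notin> J"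
        then show "u j = f (insert j J)"
          using fin by (simp add: u_def f_def indicator_exp_insert ac_simps)
      qed
      also have "\<dots> = 0"
        using add by (intro T_eq_0) (auto simp: f_def)
      finally show "taylor_coeff p (m + unit_exp j + indicator_exp J) = 0"
        by (simp add: u_def)
    qed
  qed
  show ?thesis
  proof (rule poly_eqI_taylor_coeff)
    fix m
    show "taylor_coeff p m = taylor_coeff 0 m"
      using shifted[of m, rule_format, of "{}"] p
      by (cases "Poly_Mapping.keys m \<subseteq> {..<n}")
        (auto simp: inverse_system_def polys_iff_taylor_coeff)
  qed
qed

text \<open>The solution with squarefree Taylor coefficients 1 at \<open>K\<close> and 0 elsewhere.
  \<open>Abs_poly_mapping\<close> needs finite support, which follows from the degree bound
  \<open>Tpow_delta_supp\<close>.\<close>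

definition basis_poly :: "nat set \<Rightarrow> 'k mpoly" where
  "basis_poly K = Abs_poly_mapping (\<lambda>m. if Poly_Mapping.keys m \<subseteq> {..<n}
     then Tpow n m (\<lambda>J. if J = K then 1 else 0) {} / exp_fact m else 0)"

text \<open>The supporting sets start with cardinality \<open>card K\<close> and lose one element
  per factor; a nonzero value at the empty set requires exactly \<open>card K\<close>
  factors.\<close>

lemma Tpow_delta_supp:
  assumes "K \<subseteq> {..<n}" "Poly_Mapping.keys m \<subseteq> {..<n}"
    "Tpow n m (\<lambda>J. if J = K then 1 else 0) {} \<noteq> 0"
  shows "mon_deg m = card K"
proof -
  have "J \<subseteq> {..<n} \<and> card J = card K" if "(if J = K then 1 else 0 :: 'k) \<noteq> 0" for J
    using that assms(1) by (simp split: if_splits)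
  from Tpow_supp_card[OF order_refl this assms(3)]
  have "(\<Sum>i<n. Poly_Mapping.lookup m i) = card K"
    by simp
  moreover have "mon_deg m = (\<Sum>i<n. Poly_Mapping.lookup m i)"
    unfolding mon_deg_def using assms(2) by (intro sum.mono_neutral_left) (auto simp: in_keys_iff)
  ultimately show ?thesis by simp
qed

lemma taylor_coeff_basis_poly:
  assumes "K \<subseteq> {..<n}"
  shows "taylor_coeff (basis_poly K) m =
    (if Poly_Mapping.keys m \<subseteq> {..<n} then Tpow n m (\<lambda>J. if J = K then 1 else 0) {} else 0)"
proof -
  have "finite {m. (if Poly_Mapping.keys m \<subseteq> {..<n}
     then Tpow n m (\<lambda>J. if J = K then 1 else 0) {} / exp_fact m else 0) \<noteq> (0 :: 'k)}"
    by (rule finite_subset[OF _ finite_exponents_of_degree[of n "card K"]])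
      (auto dest: Tpow_delta_supp[OF assms] split: if_splits)
  then show ?thesis
    by (simp add: taylor_coeff_def basis_poly_def)
qed

lemma taylor_coeff_basis_poly_indicator:
  assumes "K \<subseteq> {..<n}" "J \<subseteq> {..<n}"
  shows "taylor_coeff (basis_poly K) (indicator_exp J) = (if J = K then 1 else 0)"
proof -
  have "finite J" using assms(2) finite_subset by blast
  then show ?thesis
    using assms by (simp add: taylor_coeff_basis_poly keys_indicator_exp Tpow_indicator_exp)
qed

lemma homogeneous_basis_poly:
  assumes "K \<subseteq> {..<n}"
  shows "homogeneous (card K) (basis_poly K)"
  using assms by (auto simp: homogeneous_iff_taylor_coeff taylor_coeff_basis_poly dest: Tpow_delta_supp)

lemma basis_poly_in_inverse_system:
  assumes K: "K \<subseteq> {..<n}"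
  shows "basis_poly K \<in> inverse_system n M"
proof -
  have "(\<Sum>j<n. M i j * taylor_coeff (basis_poly K) (m + unit_exp j + unit_exp i)) = 0"
    if i: "i < n" for i m
  proof (cases "Poly_Mapping.keys m \<subseteq> {..<n}")
    case True
    define g where "g = Tpow n m (\<lambda>J. if J = K then 1 else 0)"
    \<comment> \<open>\<open>T i\<close> at the empty set inserts \<open>i\<close>, so equation
      \<open>i\<close> is the linear system for \<open>T\<close> on the set
      \<open>{i}\<close>.\<close>
    have "taylor_coeff (basis_poly K) (m + unit_exp j + unit_exp i) = T j g {i}" if "j < n" for j
      using that i True
      by (simp add: taylor_coeff_basis_poly[OF K] keys_add_unit_exp Tpow_add_single T_notin g_def)
    then show ?thesis
      using i by (simp add: sum_T_eq_0)
  qed (auto simp: taylor_coeff_basis_poly[OF K] keys_add_unit_exp)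
  then show ?thesis
    using K by (simp add: inverse_system_def polys_iff_taylor_coeff taylor_coeff_basis_poly)
qed

text \<open>The basis is dual to the squarefree Taylor coefficients, so both sides agree there and
  uniqueness applies to their difference.\<close>

lemma inverse_system_expand:
  assumes p: "p \<in> inverse_system n M"
  shows "p = (\<Sum>K\<in>Pow {..<n}. mp_scale (taylor_coeff p (indicator_exp K)) (basis_poly K))" (is "p = ?q")
proof -
  have "?q \<in> inverse_system n M"
    by (intro mp.subspace_sum mp.subspace_scale subspace_inverse_system basis_poly_in_inverse_system) auto
  then have "p - ?q \<in> inverse_system n M"
    using p by (intro mp.subspace_diff subspace_inverse_system)
  then have "p - ?q = 0"
  proof (rule inverse_system_eq_0I)
    fix J assume "J \<subseteq> {..<n}"
    then show "taylor_coeff (p - ?q) (indicator_exp J) = 0"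
      by (simp add: taylor_coeff_minus taylor_coeff_sum taylor_coeff_scale
          taylor_coeff_basis_poly_indicator if_distrib cong: if_cong)
  qed
  then show ?thesis by simp
qed

text \<open>Covers the whole space and its homogeneous parts alike. Independence follows from
  duality with the squarefree coefficients; the hypothesis on coefficients confines the expansion to
  \<open>\<K>\<close>.\<close>

lemma has_dim_subspace:
  assumes \<K>: "\<K> \<subseteq> Pow {..<n}" and L: "mp.subspace L" "L \<subseteq> inverse_system n M"
    and basis: "\<And>K. K \<in> \<K> \<Longrightarrow> basis_poly K \<in> L"
    and coeff: "\<And>p J. p \<in> L \<Longrightarrow> J \<subseteq> {..<n} \<Longrightarrow> J \<notin> \<K> \<Longrightarrow> taylor_coeff p (indicator_exp J) = 0"
  shows "has_dim L (card \<K>)"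
proof -
  have fin: "finite \<K>" using \<K> finite_subset by blast
  have sub: "K \<subseteq> {..<n}" if "K \<in> \<K>" for K using that \<K> by blast
  have inj: "inj_on basis_poly \<K>"
  proof (rule inj_onI)
    fix J K assume "J \<in> \<K>" "K \<in> \<K>" "basis_poly J = basis_poly K"
    then show "J = K"
      using taylor_coeff_basis_poly_indicator[of J J] taylor_coeff_basis_poly_indicator[of K J] sub
      by (auto split: if_splits)
  qed
  have span: "mp.span (basis_poly ` \<K>) = L"
  proof
    show "mp.span (basis_poly ` \<K>) \<subseteq> L"
      using basis L(1) by (intro mp.span_minimal) auto
    show "L \<subseteq> mp.span (basis_poly ` \<K>)"
    proof
      fix p assume p: "p \<in> L"
      have "p = (\<Sum>K\<in>Pow {..<n}. mp_scale (taylor_coeff p (indicator_exp K)) (basis_poly K))"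
        using p L(2) by (intro inverse_system_expand) auto
      also have "\<dots> = (\<Sum>K\<in>\<K>. mp_scale (taylor_coeff p (indicator_exp K)) (basis_poly K))"
        using \<K> coeff[OF p] by (intro sum.mono_neutral_right) auto
      also have "\<dots> \<in> mp.span (basis_poly ` \<K>)"
        by (intro mp.span_sum mp.span_scale mp.span_base) auto
      finally show "p \<in> mp.span (basis_poly ` \<K>)" .
    qed
  qed
  have indep: "mp.independent (basis_poly ` \<K>)"
  proof (rule mp.independent_if_scalars_zero)
    fix f x assume 0: "(\<Sum>x\<in>basis_poly ` \<K>. mp_scale (f x) x) = 0" and "x \<in> basis_poly ` \<K>"
    then obtain J where J: "J \<in> \<K>" "x = basis_poly J" by blast
    have "0 = taylor_coeff (\<Sum>K\<in>\<K>. mp_scale (f (basis_poly K)) (basis_poly K)) (indicator_exp J)"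
      using 0 by (simp add: sum.reindex[OF inj])
    also have "\<dots> = (\<Sum>K\<in>\<K>. if J = K then f (basis_poly K) else 0)"
      using J sub by (simp add: taylor_coeff_sum taylor_coeff_scale taylor_coeff_basis_poly_indicator
          if_distrib cong: if_cong)
    also have "\<dots> = f x"
      using J fin by simp
    finally show "f x = 0" by simp
  qed (use fin in simp)
  have "mp.dim L = card \<K>"
    using mp.dim_eq_card_independent[OF indep] mp.dim_span[of "basis_poly ` \<K>"] card_image[OF inj]
    by (simp add: span)
  then show ?thesis
    unfolding has_dim_def using span fin by blast
qed

lemma has_dim_inverse_system: "has_dim (inverse_system n M) (2 ^ n)"
proof -
  have "has_dim (inverse_system n M) (card (Pow {..<n}))"
    by (rule has_dim_subspace) (auto simp: subspace_inverse_system basis_poly_in_inverse_system)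
  then show ?thesis by (simp add: card_Pow)
qed

lemma has_dim_hom_part_inverse_system: "has_dim (hom_part (inverse_system n M) d) (n choose d)"
proof -
  let ?\<K> = "{K. K \<subseteq> {..<n} \<and> card K = d}"
  have "has_dim (hom_part (inverse_system n M) d) (card ?\<K>)"
  proof (rule has_dim_subspace)
    fix p J assume "p \<in> hom_part (inverse_system n M) d" "J \<subseteq> {..<n}" "J \<notin> ?\<K>"
    moreover from this have "mon_deg (indicator_exp J) = card J"
      by (intro mon_deg_indicator_exp) (auto intro: finite_subset)
    ultimately show "taylor_coeff p (indicator_exp J) = 0"
      by (simp add: hom_part_def homogeneous_iff_taylor_coeff)
  next
    show "mp.subspace (hom_part (inverse_system n M) d)"
      by (intro subspace_hom_part subspace_inverse_system)
  qed (auto simp: hom_part_def basis_poly_in_inverse_system homogeneous_basis_poly)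
  then show ?thesis
    using n_subsets[of "{..<n}" d] by simp
qed

end

theorem theorem2p15:
  fixes M :: "'k::field_char_0 mat" and n :: nat
  assumes "n \<ge> 1"
    and "M \<in> carrier_mat n n"
    and "\<And>J. J \<subseteq> {..<n} \<Longrightarrow> J \<noteq> {} \<Longrightarrow> det (submatrix M J J) \<noteq> 0"
  shows "graded_subspace n (Delta n M)
    \<and> (\<forall>d. has_dim (hom_part (Delta n M) d) (if d \<le> n then n choose d else 0))
    \<and> has_dim (Delta n M) (2 ^ n)"
proof -
  let ?M = "\<lambda>i j. M $$ (i, j)"
  \<comment> \<open>The empty set carries no minor, but its condition is vacuous. The implication
    inside the existential lets \<open>N\<close> be chosen for every \<open>J\<close>.\<close>
  have "\<exists>N. J \<subseteq> {..<n} \<longrightarrow> inverse_on J ?M N" for J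
  proof (cases "J = {}")
    case True
    then show ?thesis by (simp add: inverse_on_def)
  next
    case False
    then show ?thesis
      using submatrix_inverse[OF assms(2) _ assms(3)[OF _ False]] by blast
  qed
  then obtain N where N: "\<And>J. J \<subseteq> {..<n} \<Longrightarrow> inverse_on J ?M (N J)"
    by metis
  interpret principal_inverses_char_0 n ?M N
    by unfold_locales (rule N)
  have "graded_subspace n (inverse_system n ?M)"
    unfolding graded_subspace_def
    by (auto simp: subspace_inverse_system hom_comp_inverse_system) (simp add: inverse_system_def)
  moreover have "(if d \<le> n then n choose d else 0) = n choose d" for d
    by (simp add: binomial_eq_0)
  ultimately show ?thesis
    unfolding Delta_eq_inverse_system
    using has_dim_inverse_system has_dim_hom_part_inverse_system by simp
qed

end
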